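(* Suppose that $\sigma^2>0$. For every $\nu\in\mathcal{M}_{\mathcal{B}}$, for every small enough $\epsilon>0$ and for $\tilde{\mathbb{P}}$-almost every $\underline\omega$, we have $$\limsup_{n\to\infty}\frac1n\log\nu\left(\{x\in X : S_n(\underline\omega,x)>n\epsilon\}\right)\le-c(\epsilon),$$ where $c$ is the rate function of the annealed large deviation principle for $(S_n)$.
   Context: Random system. $(\Omega,\mathcal{T},\mathbb{P})$ and $(X,\mathcal{A},m)$ are probability spaces; to each $\omega\in\Omega$ is associated a map $T_\omega:X\to X$, with $(\omega,x)\mapsto T_\omega(x)$ measurable and each $T_\omega$ non-singular with respect to $m$ (i.e. $m(A)=0$ implies $m(T_\omega^{-1}A)=0$). Set $\tilde\Omega=\Omega^{\mathbb{N}}$, with elements $\underline\omega=(\omega_1,\omega_2,\ldots)$, and $\tilde{\mathbb{P}}=\mathbb{P}^{\otimes\mathbb{N}}$. The transfer operator $P_\omega$ of $T_\omega$ acts on $L^1(m)$ and is characterized by $\int_X P_\omega f\, g\,dm=\int_X f\,(g\circ T_\omega)\,dm$ for $f\in L^1(m)$, $g\in L^\infty(m)$. The annealed operators are $Pf(x)=\int_\Omega P_\omega f(x)\,d\mathbb{P}(\omega)$ on $L^1(m)$ and $Ug(x)=\int_\Omega g(T_\omega x)\,d\mathbb{P}(\omega)$ on $L^\infty(m)$. A probability measure $\mu$ on $X$ is stationary if $\mu(A)=\int_\Omega\mu(T_\omega^{-1}A)\,d\mathbb{P}(\omega)$ for all $A\in\mathcal{A}$. Standing assumptions. There is a Banach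 space $(\mathcal{B},\|\cdot\|)$ of complex-valued functions such that: (1) $\mathcal{B}$ is compactly embedded in $L^1(m)$; (2) constant functions lie in $\mathcal{B}$; (3) $\mathcal{B}$ is a complex Banach lattice: $|f|,\bar f\in\mathcal{B}$ for all $f\in\mathcal{B}$; (4) $P(\mathcal{B})\subset\mathcal{B}$ and $P$ acts continuously on $\mathcal{B}$; (5) there are $N\ge1$, $\rho<1$, $K\ge0$ with $\|P^Nf\|\le\rho\|f\|+K\|f\|_{L^1(m)}$ for all $f\in\mathcal{B}$; (6) $1$ is a simple isolated eigenvalue of $P$ on $\mathcal{B}$ and there is no other eigenvalue on the unit circle. Then there is a unique stationary probability measure absolutely continuous with respect to $m$, denoted $\mu$, with density $h\in\mathcal{B}$, $Ph=h$. There is also a Banach space $\mathcal{B}_0\subset L^1(m)$ with norm $\|\cdot\|_0$ and a constant $C>0$ with $\|fg\|\le C\|f\|_0\|g\|$ for all $f\in\mathcal{B}_0$, $g\in\mathcal{B}$. Observable. $\varphi\in\mathcal{B}_0$ is a bounded real function with $\int_X\varphi\,d\mu=0$; $X_k(\underline\omega,x)=\varphi(T_{\omega_k}\cdots T_{\omega_1}x)$ (with $X_0=\varphi(x)$), $S_n=\sum_{k=0}^{n-1}X_k$, and $\sigma^2=\lim_{n\to\infty}\frac1n\mathbb{E}_{\tilde{\mathbb{P}}\otimes\mu}(S_n^2)=\int_X\varphi^2\,d\mu+2\sum_{n=1}^\infty\int_X\varphi\,U^n\varphi\,d\mu$ (the limit exists under these assumptions). $\mathcal{M}_{\mathcal{B}}$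 is the set of probability measures on $(X,\mathcal{A})$ that are absolutely continuous with respect to $m$ with density in $\mathcal{B}$. Rate function. When $\sigma^2>0$, the annealed large deviation principle holds: there is a non-negative function $c$ on an open interval containing $0$, continuous, strictly convex and vanishing only at $0$, such that for every $\nu\in\mathcal{M}_{\mathcal{B}}$ and every sufficiently small $\epsilon>0$, $\lim_{n\to\infty}\frac1n\log\tilde{\mathbb{P}}\otimes\nu(S_n>n\epsilon)=-c(\epsilon)$. This is the function $c$ of the claim. *)

theory Defs
  imports "HOL-Probability.Probability"
begin

section \<open>Random systems\<close>

locale random_system = base: prob_space Pr + space: prob_space m
  for Pr :: "'w measure" and m :: "'x measure" +
  fixes T :: "'w \<Rightarrow> 'x \<Rightarrow> 'x"
  assumes measurable_T: "(\<lambda>(\<omega>, x). T \<omega> x) \<in> Pr \<Otimes>\<^sub>M m \<rightarrow>\<^sub>M m"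
    and nonsingular_T: "\<And>\<omega> A. \<lbrakk>\<omega> \<in> space Pr; A \<in> sets m; emeasure m A = 0\<rbrakk>
          \<Longrightarrow> emeasure m (T \<omega> -` A \<inter> space m) = 0"

abbreviation seq_measure :: "'w measure \<Rightarrow> (nat \<Rightarrow> 'w) measure" where
  "seq_measure Pr \<equiv> (\<Pi>\<^sub>M k\<in>(UNIV :: nat set). Pr)"

text \<open>Sequences are indexed from \<open>0\<close>: the entry \<open>w k\<close> is the mathematical \<open>\<omega>\<^sub>k\<^sub>+\<^sub>1\<close>, so that
  \<open>random_orbit T w k x\<close> is \<open>T\<close> at \<open>\<omega>\<^sub>k\<close> after ... after \<open>T\<close> at \<open>\<omega>\<^sub>1\<close>, applied to \<open>x\<close>.\<close>

primrec random_orbit :: "('w \<Rightarrow> 'x \<Rightarrow> 'x) \<Rightarrow> (nat \<Rightarrow> 'w) \<Rightarrow> nat \<Rightarrow> 'x \<Rightarrow> 'x" where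
  "random_orbit T w 0 x = x"
| "random_orbit T w (Suc k) x = T (w k) (random_orbit T w k x)"

definition birkhoff_sum ::
    "('w \<Rightarrow> 'x \<Rightarrow> 'x) \<Rightarrow> ('x \<Rightarrow> real) \<Rightarrow> nat \<Rightarrow> (nat \<Rightarrow> 'w) \<Rightarrow> 'x \<Rightarrow> real" where
  "birkhoff_sum T \<phi> n w x = (\<Sum>k<n. \<phi> (random_orbit T w k x))"

definition stationary :: "'w measure \<Rightarrow> 'x measure \<Rightarrow> ('w \<Rightarrow> 'x \<Rightarrow> 'x) \<Rightarrow> 'x measure \<Rightarrow> bool" where
  "stationary Pr m T \<mu> \<longleftrightarrow> prob_space \<mu> \<and> sets \<mu> = sets m \<and>
     (\<forall>A\<in>sets m. emeasure \<mu> A = (\<integral>\<^sup>+ \<omega>. emeasure \<mu> (T \<omega> -` A \<inter> space m) \<partial>Pr))"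


section \<open>Transfer operators\<close>

text \<open>Elements of \<open>L\<^sup>1(m)\<close> are represented by integrable functions, and identities in \<open>L\<^sup>1(m)\<close>
  by equality almost everywhere.\<close>

definition Linfty :: "'x measure \<Rightarrow> ('x \<Rightarrow> complex) \<Rightarrow> bool" where
  "Linfty m g \<longleftrightarrow> g \<in> borel_measurable m \<and> (\<exists>C. AE x in m. norm (g x) \<le> C)"

definition is_transfer ::
    "'x measure \<Rightarrow> ('x \<Rightarrow> 'x) \<Rightarrow> ('x \<Rightarrow> complex) \<Rightarrow> ('x \<Rightarrow> complex) \<Rightarrow> bool" where
  "is_transfer m S f Pf \<longleftrightarrow> integrable m Pf \<and>
     (\<forall>g. Linfty m g \<longrightarrow> (\<integral>x. Pf x * g x \<partial>m) = (\<integral>x. f x * g (S x) \<partial>m))"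

text \<open>Each transferred function is determined only up to a null set depending on \<open>\<omega>\<close>. The
  pointwise average over \<open>\<omega>\<close> is therefore taken of a jointly measurable choice \<open>F\<close> of versions;
  the resulting class does not depend on that choice.\<close>

definition is_annealed_transfer ::
    "'w measure \<Rightarrow> 'x measure \<Rightarrow> ('w \<Rightarrow> 'x \<Rightarrow> 'x) \<Rightarrow> ('x \<Rightarrow> complex) \<Rightarrow> ('x \<Rightarrow> complex) \<Rightarrow> bool" where
  "is_annealed_transfer Pr m T f Pf \<longleftrightarrow> integrable m Pf \<and>
     (\<exists>F. (\<lambda>(\<omega>, x). F \<omega> x) \<in> borel_measurable (Pr \<Otimes>\<^sub>M m) \<and>
          (AE \<omega> in Pr. is_transfer m (T \<omega>) f (F \<omega>)) \<and>
          (AE x in m. Pf x = (\<integral>\<omega>. F \<omega> x \<partial>Pr)))"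

definition annealed_op ::
    "'w measure \<Rightarrow> 'x measure \<Rightarrow> ('w \<Rightarrow> 'x \<Rightarrow> 'x) \<Rightarrow> ('x \<Rightarrow> complex) \<Rightarrow> ('x \<Rightarrow> complex)" where
  "annealed_op Pr m T f = (SOME Pf. is_annealed_transfer Pr m T f Pf)"


section \<open>Banach spaces inside \<open>L\<^sup>1(m)\<close>\<close>

text \<open>A linear subspace of \<open>L\<^sup>1(m)\<close> is represented by the set of all representatives of its
  elements, whence the closure under equality almost everywhere.\<close>

locale L1_banach_subspace =
  fixes m :: "'x measure" and B :: "('x \<Rightarrow> complex) set" and nB :: "('x \<Rightarrow> complex) \<Rightarrow> real"
  assumes integrable: "f \<in> B \<Longrightarrow> integrable m f"
    and AE_closed: "\<lbrakk>f \<in> B; g \<in> borel_measurable m; AE x in m. f x = g x\<rbrakk> \<Longrightarrow> g \<in> B"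
    and zero_mem: "(\<lambda>x. 0) \<in> B"
    and add_mem: "\<lbrakk>f \<in> B; g \<in> B\<rbrakk> \<Longrightarrow> (\<lambda>x. f x + g x) \<in> B"
    and scale_mem: "f \<in> B \<Longrightarrow> (\<lambda>x. a * f x) \<in> B"
    and norm_nonneg: "f \<in> B \<Longrightarrow> 0 \<le> nB f"
    and norm_eq_0_iff: "f \<in> B \<Longrightarrow> nB f = 0 \<longleftrightarrow> (AE x in m. f x = 0)"
    and norm_triangle: "\<lbrakk>f \<in> B; g \<in> B\<rbrakk> \<Longrightarrow> nB (\<lambda>x. f x + g x) \<le> nB f + nB g"
    and norm_scale: "f \<in> B \<Longrightarrow> nB (\<lambda>x. a * f x) = cmod a * nB f"
    and complete: "\<lbrakk>\<And>n. u n \<in> B;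
          \<And>e. 0 < e \<Longrightarrow> \<exists>M. \<forall>i\<ge>M. \<forall>j\<ge>M. nB (\<lambda>x. u i x - u j x) < e\<rbrakk>
          \<Longrightarrow> \<exists>f\<in>B. (\<lambda>n. nB (\<lambda>x. u n x - f x)) \<longlonglongrightarrow> 0"

definition L1_norm :: "'x measure \<Rightarrow> ('x \<Rightarrow> complex) \<Rightarrow> real" where
  "L1_norm m f = (\<integral>x. norm (f x) \<partial>m)"

definition compactly_embedded_L1 ::
    "'x measure \<Rightarrow> ('x \<Rightarrow> complex) set \<Rightarrow> (('x \<Rightarrow> complex) \<Rightarrow> real) \<Rightarrow> bool" where
  "compactly_embedded_L1 m B nB \<longleftrightarrow>
     (\<exists>C. \<forall>f\<in>B. L1_norm m f \<le> C * nB f) \<and>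
     (\<forall>u :: nat \<Rightarrow> 'x \<Rightarrow> complex. (\<forall>n. u n \<in> B) \<and> (\<exists>C. \<forall>n. nB (u n) \<le> C) \<longrightarrow>
        (\<exists>r g. strict_mono r \<and> integrable m g \<and>
           (\<lambda>n. L1_norm m (\<lambda>x. u (r n) x - g x)) \<longlonglongrightarrow> 0))"

definition eigenvalue_on ::
    "'x measure \<Rightarrow> ('x \<Rightarrow> complex) set \<Rightarrow> (('x \<Rightarrow> complex) \<Rightarrow> ('x \<Rightarrow> complex)) \<Rightarrow> complex \<Rightarrow> bool" where
  "eigenvalue_on m B L z \<longleftrightarrow>
     (\<exists>f\<in>B. \<not> (AE x in m. f x = 0) \<and> (AE x in m. L f x = z * f x))"

text \<open>Algebraic simplicity: the generalized eigenspace is one-dimensional.\<close>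

definition simple_eigenvalue_on ::
    "'x measure \<Rightarrow> ('x \<Rightarrow> complex) set \<Rightarrow> (('x \<Rightarrow> complex) \<Rightarrow> ('x \<Rightarrow> complex)) \<Rightarrow> complex \<Rightarrow> bool" where
  "simple_eigenvalue_on m B L z \<longleftrightarrow>
     (\<exists>h\<in>B. \<not> (AE x in m. h x = 0) \<and> (AE x in m. L h x = z * h x) \<and>
        (\<forall>f\<in>B. \<forall>n. (AE x in m. ((\<lambda>g x. L g x - z * g x) ^^ n) f x = 0) \<longrightarrow>
           (\<exists>a. AE x in m. f x = a * h x)))"

text \<open>The spectrum is the complement of the set of \<open>z\<close> for which \<open>z - L\<close> has a bounded inverse
  on the given space; the norm bound also yields injectivity.\<close>

definition spectrum_on ::
    "'x measure \<Rightarrow> ('x \<Rightarrow> complex) set \<Rightarrow> (('x \<Rightarrow> complex) \<Rightarrow> real) \<Rightarrow>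
     (('x \<Rightarrow> complex) \<Rightarrow> ('x \<Rightarrow> complex)) \<Rightarrow> complex set" where
  "spectrum_on m B nB L = - {z.
     (\<forall>g\<in>B. \<exists>f\<in>B. AE x in m. z * f x - L f x = g x) \<and>
     (\<exists>C. \<forall>f\<in>B. nB f \<le> C * nB (\<lambda>x. z * f x - L f x))}"


section \<open>Standing assumptions\<close>

text \<open>Since \<open>annealed_op\<close> chooses a representative, \<open>P_maps\<close> also records that the averaged
  transfer operator is well defined on \<open>B\<close>. As in the literature on transfer operators,
  a \<open>complex Banach lattice\<close> only means closure under modulus and conjugation.\<close>

locale annealed_setting = random_system Pr m T + B: L1_banach_subspace m B nB +
    B0: L1_banach_subspace m B0 nB0
  for Pr :: "'w measure" and m :: "'x measure" and T :: "'w \<Rightarrow> 'x \<Rightarrow> 'x"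
    and B :: "('x \<Rightarrow> complex) set" and nB :: "('x \<Rightarrow> complex) \<Rightarrow> real"
    and B0 :: "('x \<Rightarrow> complex) set" and nB0 :: "('x \<Rightarrow> complex) \<Rightarrow> real" +
  assumes compact_embedding: "compactly_embedded_L1 m B nB"
    and const_mem: "\<And>a. (\<lambda>x. a) \<in> B"
    and modulus_mem: "\<And>f. f \<in> B \<Longrightarrow> (\<lambda>x. complex_of_real (cmod (f x))) \<in> B"
    and cnj_mem: "\<And>f. f \<in> B \<Longrightarrow> (\<lambda>x. cnj (f x)) \<in> B"
    and P_maps: "\<And>f. f \<in> B \<Longrightarrow> \<exists>g\<in>B. is_annealed_transfer Pr m T f g"
    and P_bounded: "\<exists>C. \<forall>f\<in>B. nB (annealed_op Pr m T f) \<le> C * nB f"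
    and lasota_yorke: "\<exists>N\<ge>1. \<exists>\<rho><1. \<exists>K\<ge>0. \<forall>f\<in>B.
          nB ((annealed_op Pr m T ^^ N) f) \<le> \<rho> * nB f + K * L1_norm m f"
    and one_simple: "simple_eigenvalue_on m B (annealed_op Pr m T) 1"
    and one_isolated: "\<exists>d>0. \<forall>z\<in>spectrum_on m B nB (annealed_op Pr m T). z \<noteq> 1 \<longrightarrow> d \<le> dist z 1"
    and peripheral: "\<And>z. \<lbrakk>cmod z = 1; eigenvalue_on m B (annealed_op Pr m T) z\<rbrakk> \<Longrightarrow> z = 1"
    and multiplier: "\<exists>C>0. \<forall>f\<in>B0. \<forall>g\<in>B. (\<lambda>x. f x * g x) \<in> B \<and>
          nB (\<lambda>x. f x * g x) \<le> C * nB0 f * nB g"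

definition densities_in ::
    "'x measure \<Rightarrow> ('x \<Rightarrow> complex) set \<Rightarrow> 'x measure set" where
  "densities_in m B = {\<nu>. prob_space \<nu> \<and>
     (\<exists>g :: 'x \<Rightarrow> real. g \<in> borel_measurable m \<and> (\<forall>x. 0 \<le> g x) \<and>
        (\<lambda>x. complex_of_real (g x)) \<in> B \<and> \<nu> = density m (\<lambda>x. ennreal (g x)))}"


section \<open>Variance and rate function\<close>

definition asymptotic_variance ::
    "'w measure \<Rightarrow> ('w \<Rightarrow> 'x \<Rightarrow> 'x) \<Rightarrow> 'x measure \<Rightarrow> ('x \<Rightarrow> real) \<Rightarrow> real" where
  "asymptotic_variance Pr T \<mu> \<phi> =
     lim (\<lambda>n. (\<integral>(w, x). (birkhoff_sum T \<phi> n w x)\<^sup>2 \<partial>(seq_measure Pr \<Otimes>\<^sub>M \<mu>)) / real n)"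

text \<open>Logarithm of a probability with \<open>log 0 = -\<infinity>\<close>; the library has \<open>ln 0 = 0\<close>.\<close>

definition log_prob :: "real \<Rightarrow> ereal" where
  "log_prob p = (if p \<le> 0 then -\<infinity> else ereal (ln p))"

definition annealed_rate_function ::
    "'w measure \<Rightarrow> 'x measure \<Rightarrow> ('w \<Rightarrow> 'x \<Rightarrow> 'x) \<Rightarrow> ('x \<Rightarrow> complex) set \<Rightarrow> ('x \<Rightarrow> real) \<Rightarrow>
     (real \<Rightarrow> real) \<Rightarrow> bool" where
  "annealed_rate_function Pr m T B \<phi> c \<longleftrightarrow>
     (\<exists>I. open I \<and> is_interval I \<and> 0 \<in> I \<and> continuous_on I c \<and>
        (\<forall>x\<in>I. 0 \<le> c x) \<and> (\<forall>x\<in>I. c x = 0 \<longleftrightarrow> x = 0) \<and>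
        (\<forall>x\<in>I. \<forall>y\<in>I. \<forall>t. x \<noteq> y \<and> 0 < t \<and> t < 1 \<longrightarrow>
           c ((1 - t) * x + t * y) < (1 - t) * c x + t * c y)) \<and>
     (\<forall>\<nu>\<in>densities_in m B. \<forall>\<^sub>F \<epsilon> in at_right 0.
        (\<lambda>n. ereal (1 / real n) * log_prob (measure (seq_measure Pr \<Otimes>\<^sub>M \<nu>)
           {(w, x) \<in> space (seq_measure Pr \<Otimes>\<^sub>M \<nu>). birkhoff_sum T \<phi> n w x > real n * \<epsilon>}))
        \<longlonglongrightarrow> ereal (- c \<epsilon>))"

end

theory Submission
  imports Defs
begin

text \<open>
  The annealed probability of a deviation is the average over \<open>w\<close> of the quenched ones. By Markov's
  inequality a quenched probability can exceed its average by a factor \<open>exp (n * \<delta>)\<close> only on a set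
  of noise sequences of measure at most \<open>exp (- n * \<delta>)\<close>. These bounds are summable, so by
  Borel--Cantelli almost every sequence lies in finitely many of the exceptional sets, and the
  quenched exponential rate is at most the annealed one plus \<open>\<delta>\<close>; finally \<open>\<delta>\<close> runs through a
  sequence decreasing to \<open>0\<close>.

  This argument concerns arbitrary events in a product of two probability spaces and is stated as
  such in \<open>AE_limsup_log_prob_section_le\<close>. The dynamics enters through the measurability of the
  Birkhoff sums in \<open>(w, x)\<close>, which makes the deviation events admissible, and through the annealed
  large deviation principle, which provides the rate.
\<close>

lemma scaled_log_prob_le_iff:
  assumes "0 < n"
  shows "ereal (1 / real n) * log_prob p \<le> ereal b \<longleftrightarrow> p \<le> exp (real n * b)"
proof (cases "p \<le> 0")
  case True
  then show ?thesis
    using assms by (auto simp: log_prob_def intro: order_trans[OF _ exp_ge_zero])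
next
  case False
  then have "ln p / real n \<le> b \<longleftrightarrow> p \<le> exp (real n * b)"
    using assms exp_le_cancel_iff[of "ln p" "real n * b"] by (simp add: divide_le_eq mult.commute)
  with False show ?thesis
    by (simp add: log_prob_def)
qed

text \<open>For fixed \<open>\<delta>\<close>, half of the slack \<open>2 * \<delta>\<close> absorbs the passage from the limsup to an
  eventual bound and the other half makes the Markov bounds summable.\<close>

lemma AE_eventually_section_le:
  assumes M: "prob_space M" and N: "prob_space N"
    and A: "\<And>n. A n \<in> sets (M \<Otimes>\<^sub>M N)"
    and annealed: "limsup (\<lambda>n. ereal (1 / real n) * log_prob (measure (M \<Otimes>\<^sub>M N) (A n))) \<le> ereal a"
    and "0 < \<delta>"
  shows "AE w in M. eventually (\<lambda>n. measure N (Pair w -` A n) \<le> exp (real n * (a + 2 * \<delta>))) sequentially"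
proof -
  interpret M: prob_space M by fact
  interpret N: prob_space N by fact
  define p where "p n w = measure N (Pair w -` A n)" for n w
  define t where "t n = exp (real n * (a + 2 * \<delta>))" for n
  have p_meas [measurable]: "p n \<in> borel_measurable M" for n
    unfolding p_def using N.measurable_emeasure_Pair[OF A] by (simp add: measure_def)
  have p_int: "integrable M (p n)" for n
    by (rule M.integrable_const_bound[where B = 1]) (auto simp: p_def)
  have mean: "(\<integral>w. p n w \<partial>M) = measure (M \<Otimes>\<^sub>M N) (A n)" for n
  proof -
    have "emeasure (M \<Otimes>\<^sub>M N) (A n) = (\<integral>\<^sup>+ w. ennreal (p n w) \<partial>M)"
      unfolding p_def using N.emeasure_pair_measure_alt[OF A] by (simp add: N.emeasure_eq_measure)
    also have "\<dots> = ennreal (\<integral>w. p n w \<partial>M)"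
      by (rule nn_integral_eq_integral[OF p_int]) (simp add: p_def)
    finally show ?thesis
      by (simp add: measure_def p_def)
  qed
  have "eventually (\<lambda>n. ereal (1 / real n) * log_prob (measure (M \<Otimes>\<^sub>M N) (A n)) < ereal (a + \<delta>))
      sequentially"
    using \<open>0 < \<delta>\<close> by (intro Limsup_lessD order.strict_trans1[OF annealed]) simp
  then have mean_le: "eventually (\<lambda>n. measure (M \<Otimes>\<^sub>M N) (A n) \<le> exp (real n * (a + \<delta>))) sequentially"
    using eventually_gt_at_top[of 0]
    by eventually_elim (simp flip: scaled_log_prob_le_iff)
  have "eventually (\<lambda>n. norm (measure M {w \<in> space M. p n w \<ge> t n}) \<le> exp (- \<delta>) ^ n) sequentially"
    using mean_le
  proof eventually_elim
    case (elim n)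
    have "measure M {w \<in> space M. p n w \<ge> t n} \<le> (\<integral>w. p n w \<partial>M) / t n"
      using integral_Markov_inequality_measure[OF p_int, where A = "space M" and c = "t n"]
      by (simp add: p_def t_def)
    also have "\<dots> \<le> exp (real n * (a + \<delta>)) / t n"
      unfolding mean using elim by (intro divide_right_mono) (auto simp: t_def)
    also have "\<dots> = exp (- \<delta>) ^ n"
      by (simp add: t_def algebra_simps flip: exp_diff exp_of_nat_mult)
    finally show ?case
      by simp
  qed
  then have "summable (\<lambda>n. measure M {w \<in> space M. p n w \<ge> t n})"
    by (rule summable_comparison_test_ev) (use \<open>0 < \<delta>\<close> in \<open>simp add: summable_geometric\<close>)
  then have "AE w in M. eventually (\<lambda>n. w \<in> space M - {w \<in> space M. p n w \<ge> t n}) sequentially"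
    by (intro borel_cantelli_AE1) (auto simp: M.emeasure_eq_measure)
  then show ?thesis
    by eventually_elim (auto simp: p_def t_def elim!: eventually_mono)
qed

text \<open>The slack in the previous lemma is removed along \<open>\<delta> = 1 / Suc k\<close>: only countably many null
  sets may be discarded.\<close>

theorem AE_limsup_log_prob_section_le:
  assumes "prob_space M" "prob_space N"
    and "\<And>n. A n \<in> sets (M \<Otimes>\<^sub>M N)"
    and "limsup (\<lambda>n. ereal (1 / real n) * log_prob (measure (M \<Otimes>\<^sub>M N) (A n))) \<le> ereal a"
  shows "AE w in M. limsup (\<lambda>n. ereal (1 / real n) * log_prob (measure N (Pair w -` A n))) \<le> ereal a"
proof -
  have "AE w in M. \<forall>k. eventually (\<lambda>n. measure N (Pair w -` A n)
          \<le> exp (real n * (a + 2 * (1 / real (Suc k))))) sequentially"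
    unfolding AE_all_countable by (intro allI AE_eventually_section_le assms) simp
  then show ?thesis
  proof eventually_elim
    case (elim w)
    let ?L = "limsup (\<lambda>n. ereal (1 / real n) * log_prob (measure N (Pair w -` A n)))"
    have bound: "?L \<le> ereal (a + 2 * (1 / real (Suc k)))" for k
    proof (rule Limsup_bounded)
      show "eventually (\<lambda>n. ereal (1 / real n) * log_prob (measure N (Pair w -` A n))
              \<le> ereal (a + 2 * (1 / real (Suc k)))) sequentially"
        using elim[rule_format, of k] eventually_gt_at_top[of 0]
        by eventually_elim (simp add: scaled_log_prob_le_iff)
    qed
    have "(\<lambda>k. a + 2 * (1 / real (Suc k))) \<longlonglongrightarrow> a + 2 * 0"
      using LIMSEQ_inverse_real_of_nat by (intro tendsto_intros) (simp add: inverse_eq_divide)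
    then have "(\<lambda>k. ereal (a + 2 * (1 / real (Suc k)))) \<longlonglongrightarrow> ereal a"
      by simp
    then show ?case
      by (rule LIMSEQ_le_const) (use bound in blast)
  qed
qed

lemma (in random_system) measurable_birkhoff_sum:
  assumes phi [measurable]: "\<phi> \<in> borel_measurable m"
  shows "(\<lambda>(w, x). birkhoff_sum T \<phi> n w x) \<in> borel_measurable (seq_measure Pr \<Otimes>\<^sub>M m)"
proof -
  have orbit: "(\<lambda>(w, x). random_orbit T w k x) \<in> seq_measure Pr \<Otimes>\<^sub>M m \<rightarrow>\<^sub>M m" for k
  proof (induction k)
    case 0
    then show ?case by simp
  next
    case (Suc k)
    have "(\<lambda>z. (fst z k, random_orbit T (fst z) k (snd z)))
        \<in> seq_measure Pr \<Otimes>\<^sub>M m \<rightarrow>\<^sub>M Pr \<Otimes>\<^sub>M m"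
      using Suc by (auto simp: split_beta' intro!: measurable_Pair)
    from measurable_compose[OF this measurable_T] show ?case
      by (simp add: split_beta')
  qed
  have "(\<lambda>z. \<phi> (random_orbit T (fst z) k (snd z))) \<in> borel_measurable (seq_measure Pr \<Otimes>\<^sub>M m)" for k
    using measurable_compose[OF orbit phi] by (simp add: split_beta')
  then show ?thesis
    by (simp add: birkhoff_sum_def split_beta')
qed

theorem proposition3p14:
  fixes Pr :: "'w measure" and m :: "'x measure" and T :: "'w \<Rightarrow> 'x \<Rightarrow> 'x"
    and B B0 :: "('x \<Rightarrow> complex) set" and nB nB0 :: "('x \<Rightarrow> complex) \<Rightarrow> real"
    and \<mu> :: "'x measure" and \<phi> :: "'x \<Rightarrow> real" and c :: "real \<Rightarrow> real"
  assumes setting: "annealed_setting Pr m T B nB B0 nB0"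
    and mu: "stationary Pr m T \<mu>" "absolutely_continuous m \<mu>"
    and phi_B0: "(\<lambda>x. complex_of_real (\<phi> x)) \<in> B0"
    and phi_bounded: "\<exists>M. \<forall>x\<in>space m. \<bar>\<phi> x\<bar> \<le> M"
    and phi_centred: "(\<integral>x. \<phi> x \<partial>\<mu>) = 0"
    and variance_pos: "0 < asymptotic_variance Pr T \<mu> \<phi>"
    and rate: "annealed_rate_function Pr m T B \<phi> c"
  shows "\<forall>\<nu>\<in>densities_in m B. \<forall>\<^sub>F \<epsilon> in at_right 0. AE w in seq_measure Pr.
           limsup (\<lambda>n. ereal (1 / real n) *
             log_prob (measure \<nu> {x \<in> space \<nu>. birkhoff_sum T \<phi> n w x > real n * \<epsilon>}))
           \<le> ereal (- c \<epsilon>)"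
proof
  interpret annealed_setting Pr m T B nB B0 nB0 by (rule setting)
  fix \<nu> assume \<nu>: "\<nu> \<in> densities_in m B"
  then have prob: "prob_space \<nu>" and sets_\<nu>: "sets \<nu> = sets m"
    by (auto simp: densities_in_def)
  have prob_seq: "prob_space (seq_measure Pr)"
    by (rule prob_space_PiM) (rule base.prob_space_axioms)
  have "(\<lambda>x. Re (complex_of_real (\<phi> x))) \<in> borel_measurable m"
    by (rule measurable_compose[OF borel_measurable_integrable[OF B0.integrable[OF phi_B0]] borel_measurable_Re])
  then have "(\<lambda>(w, x). birkhoff_sum T \<phi> n w x) \<in> borel_measurable (seq_measure Pr \<Otimes>\<^sub>M m)" for n
    by (intro measurable_birkhoff_sum) simp
  then have meas: "(\<lambda>z. birkhoff_sum T \<phi> n (fst z) (snd z)) \<in> borel_measurable (seq_measure Pr \<Otimes>\<^sub>M \<nu>)" for n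
    unfolding measurable_cong_sets[OF sets_pair_measure_cong[OF refl sets_\<nu>] refl]
    by (simp add: split_beta')
  have "\<forall>\<^sub>F \<epsilon> in at_right 0.
        (\<lambda>n. ereal (1 / real n) * log_prob (measure (seq_measure Pr \<Otimes>\<^sub>M \<nu>)
           {(w, x) \<in> space (seq_measure Pr \<Otimes>\<^sub>M \<nu>). birkhoff_sum T \<phi> n w x > real n * \<epsilon>}))
        \<longlonglongrightarrow> ereal (- c \<epsilon>)"
    using rate \<nu> by (simp add: annealed_rate_function_def)
  then show "\<forall>\<^sub>F \<epsilon> in at_right 0. AE w in seq_measure Pr.
           limsup (\<lambda>n. ereal (1 / real n) *
             log_prob (measure \<nu> {x \<in> space \<nu>. birkhoff_sum T \<phi> n w x > real n * \<epsilon>}))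
           \<le> ereal (- c \<epsilon>)"
  proof eventually_elim
    case (elim \<epsilon>)
    define A where
      "A n = {(w, x) \<in> space (seq_measure Pr \<Otimes>\<^sub>M \<nu>). birkhoff_sum T \<phi> n w x > real n * \<epsilon>}" for n
    have "A n \<in> sets (seq_measure Pr \<Otimes>\<^sub>M \<nu>)" for n
      using borel_measurable_less[OF borel_measurable_const meas, of "real n * \<epsilon>" n]
      by (simp add: A_def split_beta' pred_def)
    moreover have "limsup (\<lambda>n. ereal (1 / real n) *
        log_prob (measure (seq_measure Pr \<Otimes>\<^sub>M \<nu>) (A n))) \<le> ereal (- c \<epsilon>)"
      using lim_imp_Limsup[OF _ elim] by (simp add: A_def)
    ultimately have "AE w in seq_measure Pr. limsup (\<lambda>n. ereal (1 / real n) *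
        log_prob (measure \<nu> (Pair w -` A n))) \<le> ereal (- c \<epsilon>)"
      by (intro AE_limsup_log_prob_section_le prob_seq prob)
    with AE_space show ?case
    proof eventually_elim
      case (elim w)
      then have "Pair w -` A n = {x \<in> space \<nu>. birkhoff_sum T \<phi> n w x > real n * \<epsilon>}" for n
        by (auto simp: A_def space_pair_measure)
      with elim show ?case
        by simp
    qed
  qed
qed

end
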